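(* Let $X$ be a finite connected rack, let $x_0\in X$ be a fixed element, let $n$ be the common order of the permutations $L_x$ ($x\in X$), and let $\overline{G_X}=As(X)/\langle g_{x_0}^n\rangle$ be the finite enveloping group of $X$. Let $\rho: X\to Conj(GL(V))$ be a strong representation of $X$ on a vector space $V$. Then $\rho$ induces a group representation $\bar\rho:\overline{G_X}\to GL(V)$ such that $\bar\rho_{g_x\langle g_{x_0}^n\rangle}=\rho_x$ for all $x\in X$. Furthermore, if $\rho$ is an irreducible rack representation, then $\bar\rho$ is an irreducible group representation.
   Context: A rack is a set $X$ with a binary operation $\vartriangleright$ such that for every $x\in X$ the map $L_x:X\to X$, $L_x(y)=x\vartriangleright y$, is bijective, and $x\vartriangleright(y\vartriangleright z)=(x\vartriangleright y)\vartriangleright(x\vartriangleright z)$ for all $x,y,z\in X$. A rack homomorphism is a map preserving $\vartriangleright$. For a group $G$, $Conj(G)$ is the rack on the set $G$ with $g\vartriangleright h=ghg^{-1}$. $Inn(X)$ is the group of permutations of $X$ generated by all $L_x$, $x\in X$. The rack $X$ (assumed nonempty) is connected if $Inn(X)$ acts transitively on $X$. The associated group is $As(X)=\langle g_x,\ x\in X\mid g_{x\vartriangleright y}=g_xg_yg_x^{-1},\ x,y\in X\rangle$. For a finite connected rack all permutations $L_x$ have the same order, denoted $n$; moreover in $As(X)$ the element $g_x^n$ is central and $g_x^n=g_y^n$ for all $x,y\in X$. Fixing $x_0\in X$, the finite enveloping group is the quotient $\overline{G_X}=As(X)/\langle g_{x_0}^n\rangle$. A representation of a rack $X$ on a vector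 space $V$ is a rack homomorphism $\rho:X\to Conj(GL(V))$, $x\mapsto\rho_x$, i.e. $\rho_{x\vartriangleright y}=\rho_x\rho_y\rho_x^{-1}$. It is irreducible if the only subspaces $W\subseteq V$ with $\rho_x(W)\subseteq W$ for all $x\in X$ are $\{0\}$ and $V$ (with $V\neq 0$ as usual). A stabilizing family of $X$ is a finite family (sequence, repetitions allowed) $u_1,\dots,u_k$ of elements of $X$ with $L_{u_k}L_{u_{k-1}}\cdots L_{u_1}=\mathrm{id}$. The representation $\rho$ is strong if $\rho_{u_k}\rho_{u_{k-1}}\cdots\rho_{u_1}=\mathrm{id}$ for every stabilizing family $u_1,\dots,u_k$ of $X$. *)

theory Defs
  imports "HOL-Algebra.Bij" "HOL-Algebra.Multiplicative_Group"
begin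

section \<open>Racks\<close>

record 'a rack_struct = "'a partial_object" +
  rack_op :: "'a \<Rightarrow> 'a \<Rightarrow> 'a"  (infixr \<open>\<rhd>\<index>\<close> 70)

text \<open>The translations are restricted to the carrier, so that they are elements of
  \<^const>\<open>BijGroup\<close>.\<close>

definition left_trans :: "('a, 'm) rack_struct_scheme \<Rightarrow> 'a \<Rightarrow> 'a \<Rightarrow> 'a"
  where "left_trans X x = (\<lambda>y \<in> carrier X. x \<rhd>\<^bsub>X\<^esub> y)"

locale rack =
  fixes X (structure)
  assumes left_trans_bij: "x \<in> carrier X \<Longrightarrow> bij_betw (left_trans X x) (carrier X) (carrier X)"
    and self_distrib: "\<lbrakk>x \<in> carrier X; y \<in> carrier X; z \<in> carrier X\<rbrakk>
      \<Longrightarrow> x \<rhd> (y \<rhd> z) = (x \<rhd> y) \<rhd> (x \<rhd> z)"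

definition rack_hom :: "('a, 'm) rack_struct_scheme \<Rightarrow> ('b, 'n) rack_struct_scheme \<Rightarrow> ('a \<Rightarrow> 'b) set"
  where "rack_hom X Y = {f \<in> carrier X \<rightarrow> carrier Y.
    \<forall>x \<in> carrier X. \<forall>y \<in> carrier X. f (x \<rhd>\<^bsub>X\<^esub> y) = f x \<rhd>\<^bsub>Y\<^esub> f y}"

definition Conj :: "('a, 'm) monoid_scheme \<Rightarrow> 'a rack_struct"
  where "Conj G = \<lparr>carrier = carrier G, rack_op = \<lambda>g h. g \<otimes>\<^bsub>G\<^esub> h \<otimes>\<^bsub>G\<^esub> inv\<^bsub>G\<^esub> g\<rparr>"

definition Inn :: "('a, 'm) rack_struct_scheme \<Rightarrow> ('a \<Rightarrow> 'a) set"
  where "Inn X = generate (BijGroup (carrier X)) (left_trans X ` carrier X)"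

locale connected_rack = rack +
  assumes nonempty: "carrier X \<noteq> {}"
    and transitive: "\<lbrakk>x \<in> carrier X; y \<in> carrier X\<rbrakk> \<Longrightarrow> \<exists>\<phi> \<in> Inn X. \<phi> x = y"

section \<open>Groups given by generators and relations\<close>

text \<open>A letter \<open>(x, True)\<close> stands for the generator \<open>x\<close>, and \<open>(x, False)\<close> for its inverse.\<close>

type_synonym 'a word = "('a \<times> bool) list"

definition words :: "'a set \<Rightarrow> 'a word set"
  where "words S = lists (S \<times> UNIV)"

inductive_set pres_rel :: "'a set \<Rightarrow> ('a word \<times> 'a word) set \<Rightarrow> ('a word \<times> 'a word) set"
  for S :: "'a set" and R :: "('a word \<times> 'a word) set"
  where
    refl: "u \<in> words S \<Longrightarrow> (u, u) \<in> pres_rel S R"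
  | sym: "(u, v) \<in> pres_rel S R \<Longrightarrow> (v, u) \<in> pres_rel S R"
  | trans: "(u, v) \<in> pres_rel S R \<Longrightarrow> (v, w) \<in> pres_rel S R \<Longrightarrow> (u, w) \<in> pres_rel S R"
  | append: "(u, v) \<in> pres_rel S R \<Longrightarrow> (u', v') \<in> pres_rel S R \<Longrightarrow> (u @ u', v @ v') \<in> pres_rel S R"
  | cancel: "x \<in> S \<Longrightarrow> ([(x, b), (x, \<not> b)], []) \<in> pres_rel S R"
  | rel: "(u, v) \<in> R \<Longrightarrow> u \<in> words S \<Longrightarrow> v \<in> words S \<Longrightarrow> (u, v) \<in> pres_rel S R"

definition presented_group :: "'a set \<Rightarrow> ('a word \<times> 'a word) set \<Rightarrow> 'a word set monoid"
  where "presented_group S R =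
    \<lparr>carrier = words S // pres_rel S R,
     mult = \<lambda>A B. \<Union>a \<in> A. \<Union>b \<in> B. pres_rel S R `` {a @ b},
     one = pres_rel S R `` {[]}\<rparr>"

lemma pres_rel_words: "(u, v) \<in> pres_rel S R \<Longrightarrow> u \<in> words S \<and> v \<in> words S"
  by (induction rule: pres_rel.induct) (auto simp: words_def)

lemma equiv_pres_rel: "equiv (words S) (pres_rel S R)"
proof (rule equivI)
  show "pres_rel S R \<subseteq> words S \<times> words S"
    by (auto dest: pres_rel_words)
  show "refl_on (words S) (pres_rel S R)"
    by (rule refl_onI) (rule pres_rel.refl)
  show "sym (pres_rel S R)"
    by (rule symI) (erule pres_rel.sym)
  show "trans (pres_rel S R)"
    by (rule transI) (erule (1) pres_rel.trans)
qed

lemma presented_group_mult: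
  assumes "u \<in> words S" "v \<in> words S"
  shows "(pres_rel S R `` {u}) \<otimes>\<^bsub>presented_group S R\<^esub> (pres_rel S R `` {v})
    = pres_rel S R `` {u @ v}"
proof -
  let ?c = "\<lambda>w. pres_rel S R `` {w}"
  have "?c (a @ b) = ?c (u @ v)" if "a \<in> ?c u" "b \<in> ?c v" for a b
  proof -
    have "(u @ v, a @ b) \<in> pres_rel S R"
      using that by (intro pres_rel.append) auto
    from equiv_class_eq[OF equiv_pres_rel this] show ?thesis by (rule HOL.sym)
  qed
  then have "(\<Union>a \<in> ?c u. \<Union>b \<in> ?c v. ?c (a @ b)) = (\<Union>a \<in> ?c u. \<Union>b \<in> ?c v. ?c (u @ v))"
    by (intro SUP_cong HOL.refl)
  also have "\<dots> = ?c (u @ v)"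
  proof -
    have "u \<in> ?c u" "v \<in> ?c v"
      using assms by (auto intro: pres_rel.refl)
    then show ?thesis by blast
  qed
  finally show ?thesis
    by (simp add: presented_group_def)
qed

lemma pres_rel_inverse:
  "u \<in> words S \<Longrightarrow> (rev (map (\<lambda>(x, b). (x, \<not> b)) u) @ u, []) \<in> pres_rel S R"
proof (induction u)
  case Nil
  then show ?case by (auto intro: pres_rel.refl)
next
  case (Cons l u)
  obtain x b where l: "l = (x, b)" by fastforce
  let ?i = "\<lambda>u. rev (map (\<lambda>(x, b). (x, \<not> b)) u)"
  have u: "u \<in> words S" and x: "x \<in> S" and iu: "?i u \<in> words S"
    using Cons.prems l by (auto simp: words_def)
  have "([(x, \<not> b), (x, \<not> \<not> b)], []) \<in> pres_rel S R"
    using x by (rule pres_rel.cancel)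
  from pres_rel.append[OF pres_rel.refl[OF iu] pres_rel.append[OF this pres_rel.refl[OF u]]]
  have "(?i (l # u) @ (l # u), ?i u @ u) \<in> pres_rel S R"
    by (simp add: l)
  then show ?case
    using Cons.IH[OF u] by (rule pres_rel.trans)
qed

lemma group_presented_group: "group (presented_group S R)"
proof -
  let ?G = "presented_group S R" and ?c = "\<lambda>u. pres_rel S R `` {u}"
  have carr: "A \<in> carrier ?G \<longleftrightarrow> (\<exists>u \<in> words S. A = ?c u)" for A
    by (auto simp: presented_group_def quotient_def)
  have one: "\<one>\<^bsub>?G\<^esub> = ?c []"
    by (simp add: presented_group_def)
  have nil: "[] \<in> words S" by (simp add: words_def)
  have app: "u @ v \<in> words S" if "u \<in> words S" "v \<in> words S" for u v
    using that by (auto simp: words_def)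
  show ?thesis
  proof (rule groupI)
    fix A assume "A \<in> carrier ?G"
    then obtain u where u: "u \<in> words S" "A = ?c u" by (auto simp: carr)
    let ?v = "rev (map (\<lambda>(x, b). (x, \<not> b)) u)"
    have v: "?v \<in> words S" using u(1) by (auto simp: words_def)
    have "?c ?v \<otimes>\<^bsub>?G\<^esub> A = \<one>\<^bsub>?G\<^esub>"
      using presented_group_mult[OF v u(1)] pres_rel_inverse[OF u(1)]
        equiv_class_eq[OF equiv_pres_rel] u(2) one by metis
    then show "\<exists>B \<in> carrier ?G. B \<otimes>\<^bsub>?G\<^esub> A = \<one>\<^bsub>?G\<^esub>"
      using v carr by blast
  qed (auto simp: carr one nil app presented_group_mult)
qed

section \<open>The associated group and the finite enveloping group\<close>

definition assoc_rels :: "('a, 'm) rack_struct_scheme \<Rightarrow> ('a word \<times> 'a word) set"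
  where "assoc_rels X = {([(x \<rhd>\<^bsub>X\<^esub> y, True)], [(x, True), (y, True), (x, False)]) | x y.
    x \<in> carrier X \<and> y \<in> carrier X}"

definition assoc_group :: "('a, 'm) rack_struct_scheme \<Rightarrow> 'a word set monoid"
  where "assoc_group X = presented_group (carrier X) (assoc_rels X)"

definition assoc_gen :: "('a, 'm) rack_struct_scheme \<Rightarrow> 'a \<Rightarrow> 'a word set"
  where "assoc_gen X x = pres_rel (carrier X) (assoc_rels X) `` {[(x, True)]}"

definition enveloping_kernel :: "('a, 'm) rack_struct_scheme \<Rightarrow> 'a \<Rightarrow> nat \<Rightarrow> 'a word set set"
  where "enveloping_kernel X x0 n =
    generate (assoc_group X) {assoc_gen X x0 [^]\<^bsub>assoc_group X\<^esub> n}"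

text \<open>The finite enveloping group is obtained when \<open>n\<close> is the common order of the
  translations.\<close>

definition enveloping_group :: "('a, 'm) rack_struct_scheme \<Rightarrow> 'a \<Rightarrow> nat \<Rightarrow> 'a word set set monoid"
  where "enveloping_group X x0 n = assoc_group X Mod enveloping_kernel X x0 n"

text \<open>In a connected rack the translations do have a common order.\<close>

lemma (in rack) left_trans_Bij: "x \<in> carrier X \<Longrightarrow> left_trans X x \<in> carrier (BijGroup (carrier X))"
  using left_trans_bij by (auto simp: BijGroup_def Bij_def left_trans_def)

lemma (in rack) left_trans_conj:
  assumes "x \<in> carrier X" "y \<in> carrier X"
  shows "left_trans X x \<otimes>\<^bsub>BijGroup (carrier X)\<^esub> left_trans X y
    = left_trans X (x \<rhd> y) \<otimes>\<^bsub>BijGroup (carrier X)\<^esub> left_trans X x"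
proof -
  have cl: "a \<rhd> b \<in> carrier X" if "a \<in> carrier X" "b \<in> carrier X" for a b
    using bij_betwE[OF left_trans_bij[OF that(1)]] that by (auto simp: left_trans_def)
  have B: "left_trans X x \<in> Bij (carrier X)" if "x \<in> carrier X" for x
    using left_trans_Bij[OF that] by (simp add: BijGroup_def)
  have "compose (carrier X) (left_trans X x) (left_trans X y)
    = compose (carrier X) (left_trans X (x \<rhd> y)) (left_trans X x)"
    using assms cl self_distrib[OF assms] by (intro ext) (simp add: compose_def left_trans_def)
  then show ?thesis
    using assms cl by (simp add: BijGroup_def B)
qed

lemma (in group) ord_conj_eq:
  assumes "a \<in> carrier G" "b \<in> carrier G" "c \<in> carrier G" "a \<otimes> b = c \<otimes> a"
  shows "ord b = ord c"
proof -
  have *: "a \<otimes> b [^] k = c [^] k \<otimes> a" for k :: nat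
  proof (induction k)
    case (Suc k)
    have "a \<otimes> b [^] Suc k = (a \<otimes> b [^] k) \<otimes> b" using assms by (simp add: m_assoc)
    also have "\<dots> = c [^] k \<otimes> (a \<otimes> b)" using assms Suc by (simp add: m_assoc)
    also have "\<dots> = c [^] Suc k \<otimes> a" using assms by (simp add: m_assoc)
    finally show ?case .
  qed (use assms in auto)
  have "b [^] k = \<one> \<longleftrightarrow> c [^] k = \<one>" for k :: nat
    using *[of k] assms by (metis l_one nat_pow_closed r_cancel_one' l_cancel_one' r_one)
  then show ?thesis
    by (simp add: ord_def)
qed

lemma (in connected_rack) common_order:
  "\<exists>!n. \<forall>x \<in> carrier X. group.ord (BijGroup (carrier X)) (left_trans X x) = n"
proof -
  let ?B = "BijGroup (carrier X)"
  interpret B: group ?B by (rule group_BijGroup)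
  let ?o = "\<lambda>x. B.ord (left_trans X x)"
  have gen: "left_trans X ` carrier X \<subseteq> carrier ?B" using left_trans_Bij by auto
  have cl: "\<phi> x \<in> carrier X" if "\<phi> \<in> carrier ?B" "x \<in> carrier X" for \<phi> x
    using that by (auto simp: BijGroup_def Bij_def bij_betw_def)
  have step: "left_trans X a x \<in> carrier X \<and> ?o (left_trans X a x) = ?o x"
    if "a \<in> carrier X" "x \<in> carrier X" for a x
    using that cl[OF left_trans_Bij] left_trans_conj[OF that]
      B.ord_conj_eq[of "left_trans X a" "left_trans X x" "left_trans X (a \<rhd> x)"] left_trans_Bij
    by (auto simp: left_trans_def)
  have comp: "(f \<otimes>\<^bsub>?B\<^esub> g) x = f (g x)"
    if "f \<in> carrier ?B" "g \<in> carrier ?B" "x \<in> carrier X" for f g x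
    using that by (auto simp: BijGroup_def compose_def)
  have inv: "?o ((inv\<^bsub>?B\<^esub> left_trans X a) x) = ?o x" if "a \<in> carrier X" "x \<in> carrier X" for a x
  proof -
    let ?y = "(inv\<^bsub>?B\<^esub> left_trans X a) x"
    have y: "?y \<in> carrier X" using cl left_trans_Bij that by auto
    have "left_trans X a ?y = (left_trans X a \<otimes>\<^bsub>?B\<^esub> inv\<^bsub>?B\<^esub> left_trans X a) x"
      using comp[OF left_trans_Bij[OF that(1)] B.inv_closed[OF left_trans_Bij[OF that(1)]] that(2)]
      by (rule HOL.sym)
    also have "\<dots> = x"
      using B.r_inv[OF left_trans_Bij[OF that(1)]] that(2) by (simp add: BijGroup_def)
    finally show ?thesis using step[OF that(1) y] by simp
  qed
  have inn: "?o (\<phi> x) = ?o x" if "\<phi> \<in> Inn X" "x \<in> carrier X" for \<phi> x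
    using that unfolding Inn_def
  proof (induction arbitrary: x rule: generate.induct)
    case one
    then show ?case by (simp add: BijGroup_def)
  next
    case (incl h)
    then show ?case using step by auto
  next
    case (inv h)
    then show ?case using \<open>\<And>a x. a \<in> carrier X \<Longrightarrow> x \<in> carrier X \<Longrightarrow> ?o ((inv\<^bsub>?B\<^esub> left_trans X a) x) = ?o x\<close>
      by auto
  next
    case (eng h1 h2)
    then have "h1 \<in> carrier ?B" "h2 \<in> carrier ?B"
      using B.generate_in_carrier[OF gen] by auto
    then show ?case using eng comp cl by simp
  qed
  obtain x where x: "x \<in> carrier X" using nonempty by auto
  have "?o y = ?o x" if "y \<in> carrier X" for y
  proof -
    obtain \<phi> where "\<phi> \<in> Inn X" "\<phi> x = y" using transitive[OF x \<open>y \<in> carrier X\<close>] by blast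
    then show ?thesis using inn[of \<phi> x] x by simp
  qed
  then have "\<forall>y \<in> carrier X. ?o y = ?o x" by blast
  moreover have "n = ?o x" if "\<forall>y \<in> carrier X. ?o y = n" for n
    using bspec[OF that x] by (rule HOL.sym)
  ultimately show ?thesis by (rule ex1I)
qed

section \<open>Linear representations\<close>

definition GL :: "('k::field \<Rightarrow> 'v::ab_group_add \<Rightarrow> 'v) \<Rightarrow> ('v \<Rightarrow> 'v) monoid"
  where "GL scale = \<lparr>carrier = {f. Vector_Spaces.linear scale scale f \<and> bij f}, mult = (\<circ>), one = id\<rparr>"

lemma group_GL:
  assumes "vector_space scale"
  shows "group (GL scale)"
proof (rule groupI)
  interpret vector_space scale by fact
  show "\<one>\<^bsub>GL scale\<^esub> \<in> carrier (GL scale)"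
    by (simp add: GL_def linear_id[unfolded id_def[symmetric]])
  fix f assume "f \<in> carrier (GL scale)"
  then have f: "Vector_Spaces.linear scale scale f" "bij f" by (auto simp: GL_def)
  have "Vector_Spaces.linear scale scale (inv_into UNIV f)"
  proof -
    interpret f: Vector_Spaces.linear scale scale f by fact
    have r: "f (inv_into UNIV f x) = x" for x using f(2) by (simp add: bij_is_surj surj_f_inv_f)
    have "inj f" using f(2) by (rule bij_is_inj)
    then have "inv_into UNIV f (x + y) = inv_into UNIV f x + inv_into UNIV f y" for x y
      by (rule injD) (simp add: r f.add)
    moreover have "inv_into UNIV f (scale c x) = scale c (inv_into UNIV f x)" for c x
      using \<open>inj f\<close> by (rule injD) (simp add: r f.scale)
    ultimately show ?thesis
      by unfold_locales
  qed
  moreover have "inv_into UNIV f \<circ> f = id" using f(2) by (simp add: bij_is_inj)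
  ultimately show "\<exists>g \<in> carrier (GL scale). g \<otimes>\<^bsub>GL scale\<^esub> f = \<one>\<^bsub>GL scale\<^esub>"
    using f(2) by (intro bexI[of _ "inv_into UNIV f"]) (auto simp: GL_def bij_imp_bij_inv)
qed (auto simp: GL_def comp_assoc bij_comp intro: Vector_Spaces.linear_compose)

text \<open>A family of operators on a nonzero space, indexed by \<open>I\<close>, without nontrivial invariant
  subspaces.\<close>

definition irreducible_family ::
    "('k::field \<Rightarrow> 'v::ab_group_add \<Rightarrow> 'v) \<Rightarrow> 'i set \<Rightarrow> ('i \<Rightarrow> 'v \<Rightarrow> 'v) \<Rightarrow> bool"
  where "irreducible_family scale I T \<longleftrightarrow> (UNIV :: 'v set) \<noteq> {0} \<and>
    (\<forall>W. Modules.module.subspace scale W \<and> (\<forall>i \<in> I. T i ` W \<subseteq> W) \<longrightarrow> W = {0} \<or> W = UNIV)"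

definition rack_representation ::
    "('k::field \<Rightarrow> 'v::ab_group_add \<Rightarrow> 'v) \<Rightarrow> ('a, 'm) rack_struct_scheme \<Rightarrow> ('a \<Rightarrow> 'v \<Rightarrow> 'v) \<Rightarrow> bool"
  where "rack_representation scale X \<rho> \<longleftrightarrow> \<rho> \<in> rack_hom X (Conj (GL scale))"

definition irreducible_rack_representation ::
    "('k::field \<Rightarrow> 'v::ab_group_add \<Rightarrow> 'v) \<Rightarrow> ('a, 'm) rack_struct_scheme \<Rightarrow> ('a \<Rightarrow> 'v \<Rightarrow> 'v) \<Rightarrow> bool"
  where "irreducible_rack_representation scale X \<rho> \<longleftrightarrow>
    rack_representation scale X \<rho> \<and> irreducible_family scale (carrier X) \<rho>"

definition group_representation ::
    "('k::field \<Rightarrow> 'v::ab_group_add \<Rightarrow> 'v) \<Rightarrow> ('g, 'm) monoid_scheme \<Rightarrow> ('g \<Rightarrow> 'v \<Rightarrow> 'v) \<Rightarrow> bool"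
  where "group_representation scale G \<sigma> \<longleftrightarrow> group_hom G (GL scale) \<sigma>"

definition irreducible_group_representation ::
    "('k::field \<Rightarrow> 'v::ab_group_add \<Rightarrow> 'v) \<Rightarrow> ('g, 'm) monoid_scheme \<Rightarrow> ('g \<Rightarrow> 'v \<Rightarrow> 'v) \<Rightarrow> bool"
  where "irreducible_group_representation scale G \<sigma> \<longleftrightarrow>
    group_representation scale G \<sigma> \<and> irreducible_family scale (carrier G) \<sigma>"

section \<open>Stabilizing families and strong representations\<close>

text \<open>\<open>rev_prod G f [u\<^sub>1, \<dots>, u\<^sub>k]\<close> is the product \<open>f u\<^sub>k \<otimes> \<dots> \<otimes> f u\<^sub>1\<close>.\<close>

definition rev_prod :: "('g, 'm) monoid_scheme \<Rightarrow> ('a \<Rightarrow> 'g) \<Rightarrow> 'a list \<Rightarrow> 'g"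
  where "rev_prod G f us = fold (\<lambda>u p. f u \<otimes>\<^bsub>G\<^esub> p) us \<one>\<^bsub>G\<^esub>"

definition stabilizing_family :: "('a, 'm) rack_struct_scheme \<Rightarrow> 'a list \<Rightarrow> bool"
  where "stabilizing_family X us \<longleftrightarrow> set us \<subseteq> carrier X \<and>
    rev_prod (BijGroup (carrier X)) (left_trans X) us = \<one>\<^bsub>BijGroup (carrier X)\<^esub>"

definition strong_representation ::
    "('k::field \<Rightarrow> 'v::ab_group_add \<Rightarrow> 'v) \<Rightarrow> ('a, 'm) rack_struct_scheme \<Rightarrow> ('a \<Rightarrow> 'v \<Rightarrow> 'v) \<Rightarrow> bool"
  where "strong_representation scale X \<rho> \<longleftrightarrow> rack_representation scale X \<rho> \<and>
    (\<forall>us. stabilizing_family X us \<longrightarrow> rev_prod (GL scale) \<rho> us = \<one>\<^bsub>GL scale\<^esub>)"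

end

theory Submission
  imports Defs "HOL-Algebra.Generated_Groups"
begin

text \<open>
  The relations of the associated group say exactly that a rack homomorphism from \<open>X\<close> into the
  conjugation rack of a group extends to a group homomorphism on \<open>As(X)\<close>. So any representation
  \<open>\<rho>\<close> of \<open>X\<close> extends to \<open>As(X)\<close>, and strength is what lets it descend further: the list consisting
  of \<open>n\<close> copies of \<open>x\<^sub>0\<close> is a stabilizing family, because \<open>n\<close> is the order of the translation by
  \<open>x\<^sub>0\<close>, hence the \<open>n\<close>-th power of \<open>\<rho> x\<^sub>0\<close> is the identity, and the extension is trivial on the
  subgroup generated by the \<open>n\<close>-th power of the generator of \<open>x\<^sub>0\<close>.

  The quotient by this subgroup is a group because that power is central
  (\<open>assoc_gen_pow_central\<close>): in \<open>As(X)\<close>, conjugation by the generator of \<open>x\<close> permutes the generators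
  in the same way as the translation by \<open>x\<close> permutes \<open>X\<close>, so its \<open>n\<close>-th power fixes every generator.

  Irreducibility is inherited since the operators \<open>\<rho> x\<close> occur among the operators of the induced
  representation, so that a subspace invariant under the group is invariant under the rack.
\<close>

section \<open>Homomorphisms out of a presented group\<close>

definition word_value :: "('g, 'm) monoid_scheme \<Rightarrow> ('a \<Rightarrow> 'g) \<Rightarrow> 'a word \<Rightarrow> 'g"
  where "word_value G f w =
    foldr (\<lambda>(x, b) p. (if b then f x else inv\<^bsub>G\<^esub> f x) \<otimes>\<^bsub>G\<^esub> p) w \<one>\<^bsub>G\<^esub>"

context group
begin

lemma word_value_closed:
  assumes "f \<in> S \<rightarrow> carrier G" "w \<in> words S"
  shows "word_value G f w \<in> carrier G"
proof -
  have "f x \<in> carrier G" if "x \<in> S" for x using assms(1) that by blast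
  with assms(2) show ?thesis unfolding words_def
    by (induction w rule: lists.induct) (auto simp: word_value_def)
qed

lemma word_value_append:
  assumes "f \<in> S \<rightarrow> carrier G" "u \<in> words S" "v \<in> words S"
  shows "word_value G f (u @ v) = word_value G f u \<otimes> word_value G f v"
proof -
  have cl: "f x \<in> carrier G" if "x \<in> S" for x using assms(1) that by blast
  have v: "word_value G f v \<in> carrier G" using assms(1,3) by (rule word_value_closed)
  show ?thesis
    using assms(2) unfolding words_def
  proof (induction u rule: lists.induct)
    case Nil
    then show ?case using v by (simp add: word_value_def)
  next
    case (Cons l u)
    obtain x b where l: "l = (x, b)" "x \<in> S" using Cons.hyps by auto
    have "word_value G f u \<in> carrier G"
      using word_value_closed[OF assms(1)] Cons.hyps by (simp add: words_def)
    moreover have Cons_value: "word_value G f (l # w) =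
        (if b then f x else inv f x) \<otimes> word_value G f w" for w
      by (simp add: word_value_def l)
    ultimately show ?case
      using cl[OF l(2)] v Cons.IH by (simp add: m_assoc)
  qed
qed

lemma word_value_respects_pres_rel:
  assumes f: "f \<in> S \<rightarrow> carrier G"
    and R: "\<And>u v. (u, v) \<in> R \<Longrightarrow> u \<in> words S \<Longrightarrow> v \<in> words S
      \<Longrightarrow> word_value G f u = word_value G f v"
    and "(u, v) \<in> pres_rel S R"
  shows "word_value G f u = word_value G f v"
  using assms(3)
proof (induction rule: pres_rel.induct)
  case (append u v u' v')
  then show ?case
    using word_value_append[OF f] pres_rel_words[of u v S R] pres_rel_words[of u' v' S R] by simp
next
  case (cancel x b)
  then show ?case using f by (auto simp: word_value_def Pi_iff)
qed (use R in auto)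

text \<open>Von Dyck's theorem: by the preceding lemma the value of a word depends only on its class, so the
  value of any representative defines the homomorphism.\<close>

lemma presented_group_universal:
  assumes f: "f \<in> S \<rightarrow> carrier G"
    and R: "\<And>u v. (u, v) \<in> R \<Longrightarrow> u \<in> words S \<Longrightarrow> v \<in> words S
      \<Longrightarrow> word_value G f u = word_value G f v"
  obtains h where "h \<in> hom (presented_group S R) G"
    and "\<And>x. x \<in> S \<Longrightarrow> h (pres_rel S R `` {[(x, True)]}) = f x"
proof -
  let ?c = "\<lambda>w. pres_rel S R `` {w}"
  define h where "h A = word_value G f (SOME w. w \<in> A)" for A
  have h: "h (?c w) = word_value G f w" if "w \<in> words S" for w
  proof -
    have "w \<in> ?c w" using that by (auto intro: pres_rel.refl)
    then have "(SOME v. v \<in> ?c w) \<in> ?c w" by (rule someI)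
    then have "(w, SOME v. v \<in> ?c w) \<in> pres_rel S R" by blast
    from word_value_respects_pres_rel[OF f R this] show ?thesis
      by (simp add: h_def)
  qed
  have "h \<in> hom (presented_group S R) G"
  proof (rule homI)
    fix A assume "A \<in> carrier (presented_group S R)"
    then obtain u where u: "u \<in> words S" "A = ?c u"
      by (auto simp: presented_group_def quotient_def)
    then show "h A \<in> carrier G" using h word_value_closed[OF f] by simp
    fix B assume "B \<in> carrier (presented_group S R)"
    then obtain v where v: "v \<in> words S" "B = ?c v"
      by (auto simp: presented_group_def quotient_def)
    have "u @ v \<in> words S" using u v by (simp add: words_def)
    then show "h (A \<otimes>\<^bsub>presented_group S R\<^esub> B) = h A \<otimes> h B"
      using u v by (simp add: presented_group_mult h word_value_append[OF f])
  qed
  moreover have "h (?c [(x, True)]) = f x" if "x \<in> S" for x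
    using that f by (subst h) (auto simp: words_def word_value_def Pi_iff)
  ultimately show thesis by (rule that)
qed

end

lemma presented_group_generated:
  "carrier (presented_group S R) \<subseteq>
    generate (presented_group S R) ((\<lambda>x. pres_rel S R `` {[(x, True)]}) ` S)"
proof
  let ?G = "presented_group S R" and ?c = "\<lambda>w. pres_rel S R `` {w}"
  let ?gen = "generate ?G ((\<lambda>x. ?c [(x, True)]) ` S)"
  interpret G: group ?G by (rule group_presented_group)
  have carr: "?c w \<in> carrier ?G" if "w \<in> words S" for w
    using that by (auto simp: presented_group_def quotient_def)
  have letter: "?c [(x, b)] \<in> ?gen" if x: "x \<in> S" for x b
  proof (cases b)
    case True
    then show ?thesis using x by (auto intro: generate.incl)
  next
    case False
    have w: "[(x, b)] \<in> words S" for b using x by (simp add: words_def)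
    have "?c [(x, False)] \<otimes>\<^bsub>?G\<^esub> ?c [(x, True)] = ?c [(x, False), (x, \<not> False)]"
      using presented_group_mult[OF w w] by simp
    also have "\<dots> = \<one>\<^bsub>?G\<^esub>"
      using equiv_class_eq[OF equiv_pres_rel pres_rel.cancel[OF x, where b = False]]
      by (simp add: presented_group_def)
    finally have "inv\<^bsub>?G\<^esub> ?c [(x, True)] = ?c [(x, False)]"
      using carr[OF w] by (intro G.inv_equality)
    moreover have "inv\<^bsub>?G\<^esub> ?c [(x, True)] \<in> ?gen" using x by (auto intro: generate.inv)
    ultimately show ?thesis using False by simp
  qed
  have word: "?c w \<in> ?gen" if "w \<in> lists (S \<times> UNIV)" for w
    using that
  proof (induction w rule: lists.induct)
    case Nil
    then show ?case using generate.one[of ?G] by (simp add: presented_group_def)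
  next
    case (Cons l w)
    then obtain x b where l: "l = (x, b)" "x \<in> S" by auto
    have "?c (l # w) = ?c [l] \<otimes>\<^bsub>?G\<^esub> ?c w"
      using presented_group_mult[of "[l]" S w R] l Cons.hyps by (simp add: words_def)
    then show ?case using generate.eng[OF letter Cons.IH] l by simp
  qed
  fix A assume "A \<in> carrier ?G"
  then obtain w where "w \<in> words S" "A = ?c w"
    by (auto simp: presented_group_def quotient_def)
  then show "A \<in> ?gen" using word by (simp add: words_def)
qed

lemma (in group) commutes_with_generate:
  assumes z: "z \<in> carrier G" and K: "K \<subseteq> carrier G"
    and comm: "\<And>k. k \<in> K \<Longrightarrow> z \<otimes> k = k \<otimes> z" and "a \<in> generate G K"
  shows "z \<otimes> a = a \<otimes> z"
  using assms(4)
proof (induction rule: generate.induct)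
  case (inv k)
  then have k: "k \<in> carrier G" using K by blast
  have "inv k \<otimes> (z \<otimes> k) \<otimes> inv k = inv k \<otimes> (k \<otimes> z) \<otimes> inv k"
    using comm[OF inv] by simp
  moreover have "inv k \<otimes> (z \<otimes> k) \<otimes> inv k = inv k \<otimes> z"
    using k z by (simp add: m_assoc)
  moreover have "inv k \<otimes> (k \<otimes> z) \<otimes> inv k = z \<otimes> inv k"
    using k z by (simp add: m_assoc[symmetric])
  ultimately show ?case by simp
next
  case (eng a b)
  then have "a \<in> carrier G" "b \<in> carrier G" using generate_in_carrier[OF K] by auto
  then show ?case using z eng.IH by (metis m_assoc)
qed (use z comm in auto)

section \<open>The associated group of a rack\<close>

lemma group_assoc_group: "group (assoc_group X)"
  unfolding assoc_group_def by (rule group_presented_group)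

lemma assoc_gen_closed: "x \<in> carrier X \<Longrightarrow> assoc_gen X x \<in> carrier (assoc_group X)"
  by (auto simp: assoc_gen_def assoc_group_def presented_group_def quotient_def words_def)

context rack
begin

lemma rack_op_closed: "x \<in> carrier X \<Longrightarrow> y \<in> carrier X \<Longrightarrow> x \<rhd> y \<in> carrier X"
  using bij_betwE[OF left_trans_bij] by (fastforce simp: left_trans_def)

text \<open>The defining relation of \<open>As(X)\<close>, cleared of inverses.\<close>

lemma assoc_gen_commute:
  assumes x: "x \<in> carrier X" and y: "y \<in> carrier X"
  shows "assoc_gen X x \<otimes>\<^bsub>assoc_group X\<^esub> assoc_gen X y
    = assoc_gen X (x \<rhd> y) \<otimes>\<^bsub>assoc_group X\<^esub> assoc_gen X x"
proof -
  let ?S = "carrier X" and ?R = "assoc_rels X"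
  have w: "[(x, True), (y, True), (x, False)] \<in> words ?S" "[(x \<rhd> y, True)] \<in> words ?S"
    "[(x, True)] \<in> words ?S" "[(y, True)] \<in> words ?S"
    using x y rack_op_closed by (auto simp: words_def)
  have "([(x \<rhd> y, True)], [(x, True), (y, True), (x, False)]) \<in> pres_rel ?S ?R"
    using x y w by (intro pres_rel.rel) (auto simp: assoc_rels_def)
  from pres_rel.append[OF this pres_rel.refl[OF w(3)]]
  have "([(x \<rhd> y, True), (x, True)], [(x, True), (y, True), (x, False), (x, True)])
    \<in> pres_rel ?S ?R" by simp
  moreover have "([(x, True), (y, True), (x, False), (x, True)], [(x, True), (y, True)])
    \<in> pres_rel ?S ?R"
    using pres_rel.append[OF pres_rel.append[OF pres_rel.refl[OF w(3)] pres_rel.refl[OF w(4)]]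
        pres_rel.cancel[OF x, where b = False]] by simp
  ultimately have "([(x \<rhd> y, True), (x, True)], [(x, True), (y, True)]) \<in> pres_rel ?S ?R"
    by (rule pres_rel.trans)
  from equiv_class_eq[OF equiv_pres_rel this] show ?thesis
    using presented_group_mult[OF w(2,3), of ?R] presented_group_mult[OF w(3,4), of ?R]
    by (simp add: assoc_gen_def assoc_group_def)
qed

lemma assoc_gen_pow_commute:
  assumes x: "x \<in> carrier X" and y: "y \<in> carrier X"
  defines "t k \<equiv> (left_trans X x [^]\<^bsub>BijGroup (carrier X)\<^esub> k) y"
  shows "t k \<in> carrier X \<and>
    assoc_gen X x [^]\<^bsub>assoc_group X\<^esub> (k::nat) \<otimes>\<^bsub>assoc_group X\<^esub> assoc_gen X y
    = assoc_gen X (t k) \<otimes>\<^bsub>assoc_group X\<^esub> assoc_gen X x [^]\<^bsub>assoc_group X\<^esub> k"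
proof (induction k)
  interpret A: group "assoc_group X" by (rule group_assoc_group)
  case 0
  then show ?case using y by (simp add: t_def BijGroup_def assoc_gen_closed)
next
  interpret A: group "assoc_group X" by (rule group_assoc_group)
  interpret B: group "BijGroup (carrier X)" by (rule group_BijGroup)
  case (Suc k)
  let ?g = "assoc_gen X" and ?L = "left_trans X x [^]\<^bsub>BijGroup (carrier X)\<^esub> k"
  have L: "left_trans X x \<in> carrier (BijGroup (carrier X))"
    using left_trans_Bij[OF x] .
  have comp: "(\<alpha> \<otimes>\<^bsub>BijGroup (carrier X)\<^esub> \<beta>) y = \<alpha> (\<beta> y)"
    if "\<alpha> \<in> carrier (BijGroup (carrier X))" "\<beta> \<in> carrier (BijGroup (carrier X))" for \<alpha> \<beta>
    using that y by (simp add: BijGroup_def compose_def)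
  have tk: "t k \<in> carrier X" using Suc.IH by blast
  have "t (Suc k) = (left_trans X x \<otimes>\<^bsub>BijGroup (carrier X)\<^esub> ?L) y"
    unfolding t_def B.nat_pow_Suc2[OF L] by (rule HOL.refl)
  also have "\<dots> = left_trans X x (t k)"
    unfolding t_def using L B.nat_pow_closed[OF L] by (rule comp)
  also have "\<dots> = x \<rhd> t k"
    using tk by (simp add: left_trans_def)
  finally have t: "t (Suc k) = x \<rhd> t k" .
  let ?p = "?g x [^]\<^bsub>assoc_group X\<^esub> k"
  have g: "?g x \<in> carrier (assoc_group X)" "?g y \<in> carrier (assoc_group X)"
    "?g (t k) \<in> carrier (assoc_group X)" "?g (x \<rhd> t k) \<in> carrier (assoc_group X)"
    using x y tk rack_op_closed by (simp_all add: assoc_gen_closed)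
  have p: "?p \<in> carrier (assoc_group X)" using g by simp
  have pow: "?g x [^]\<^bsub>assoc_group X\<^esub> Suc k = ?g x \<otimes>\<^bsub>assoc_group X\<^esub> ?p"
    using g(1) by (rule A.nat_pow_Suc2)
  have "?g x [^]\<^bsub>assoc_group X\<^esub> Suc k \<otimes>\<^bsub>assoc_group X\<^esub> ?g y
      = ?g x \<otimes>\<^bsub>assoc_group X\<^esub> (?p \<otimes>\<^bsub>assoc_group X\<^esub> ?g y)"
    unfolding pow using g(1) p g(2) by (rule A.m_assoc)
  also have "\<dots> = ?g x \<otimes>\<^bsub>assoc_group X\<^esub> (?g (t k) \<otimes>\<^bsub>assoc_group X\<^esub> ?p)"
    using Suc.IH by (rule conjE) (rule arg_cong)
  also have "\<dots> = (?g x \<otimes>\<^bsub>assoc_group X\<^esub> ?g (t k)) \<otimes>\<^bsub>assoc_group X\<^esub> ?p"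
    using A.m_assoc[OF g(1,3) p] by (rule HOL.sym)
  also have "\<dots> = (?g (x \<rhd> t k) \<otimes>\<^bsub>assoc_group X\<^esub> ?g x) \<otimes>\<^bsub>assoc_group X\<^esub> ?p"
    unfolding assoc_gen_commute[OF x tk] by (rule HOL.refl)
  also have "\<dots> = ?g (t (Suc k)) \<otimes>\<^bsub>assoc_group X\<^esub> ?g x [^]\<^bsub>assoc_group X\<^esub> Suc k"
    unfolding pow t using g(4,1) p by (rule A.m_assoc)
  finally show ?case
    unfolding t using rack_op_closed[OF x tk] by (rule conjI[rotated])
qed

text \<open>Conjugation by \<open>g\<^sub>x\<close> to the \<open>n\<close> moves the generator of \<open>y\<close> to that of the image of \<open>y\<close> under
  the \<open>n\<close>-th power of the translation by \<open>x\<close>, which is \<open>y\<close> itself, and the generators generate.\<close>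

lemma assoc_gen_pow_central:
  assumes x: "x \<in> carrier X"
    and n: "left_trans X x [^]\<^bsub>BijGroup (carrier X)\<^esub> (n::nat) = \<one>\<^bsub>BijGroup (carrier X)\<^esub>"
    and a: "a \<in> carrier (assoc_group X)"
  shows "assoc_gen X x [^]\<^bsub>assoc_group X\<^esub> n \<otimes>\<^bsub>assoc_group X\<^esub> a
    = a \<otimes>\<^bsub>assoc_group X\<^esub> assoc_gen X x [^]\<^bsub>assoc_group X\<^esub> n"
proof (rule group.commutes_with_generate[OF group_assoc_group])
  interpret A: group "assoc_group X" by (rule group_assoc_group)
  show "assoc_gen X x [^]\<^bsub>assoc_group X\<^esub> n \<in> carrier (assoc_group X)"
    using x by (simp add: assoc_gen_closed)
  show "assoc_gen X ` carrier X \<subseteq> carrier (assoc_group X)"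
    by (auto simp: assoc_gen_closed)
  show "a \<in> generate (assoc_group X) (assoc_gen X ` carrier X)"
    using a presented_group_generated[of "carrier X" "assoc_rels X"]
    by (auto simp: assoc_group_def assoc_gen_def[abs_def])
next
  fix k assume "k \<in> assoc_gen X ` carrier X"
  then obtain y where y: "y \<in> carrier X" "k = assoc_gen X y" by blast
  show "assoc_gen X x [^]\<^bsub>assoc_group X\<^esub> n \<otimes>\<^bsub>assoc_group X\<^esub> k
    = k \<otimes>\<^bsub>assoc_group X\<^esub> assoc_gen X x [^]\<^bsub>assoc_group X\<^esub> n"
    using assoc_gen_pow_commute[OF x y(1), of n] y by (simp add: n) (simp add: BijGroup_def)
qed

lemma enveloping_kernel_normal:
  assumes x: "x \<in> carrier X"
    and n: "left_trans X x [^]\<^bsub>BijGroup (carrier X)\<^esub> n = \<one>\<^bsub>BijGroup (carrier X)\<^esub>"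
  shows "enveloping_kernel X x n \<lhd> assoc_group X"
  unfolding enveloping_kernel_def
proof (rule group.normal_generateI[OF group_assoc_group])
  interpret A: group "assoc_group X" by (rule group_assoc_group)
  let ?z = "assoc_gen X x [^]\<^bsub>assoc_group X\<^esub> n"
  have z: "?z \<in> carrier (assoc_group X)" using x by (simp add: assoc_gen_closed)
  then show "{?z} \<subseteq> carrier (assoc_group X)" by simp
  fix h a assume "h \<in> {?z}" and a: "a \<in> carrier (assoc_group X)"
  then have "a \<otimes>\<^bsub>assoc_group X\<^esub> h \<otimes>\<^bsub>assoc_group X\<^esub> inv\<^bsub>assoc_group X\<^esub> a
      = ?z \<otimes>\<^bsub>assoc_group X\<^esub> a \<otimes>\<^bsub>assoc_group X\<^esub> inv\<^bsub>assoc_group X\<^esub> a"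
    using assoc_gen_pow_central[OF x n a] by simp
  also have "\<dots> = ?z" using a z by (simp add: A.m_assoc)
  finally show "a \<otimes>\<^bsub>assoc_group X\<^esub> h \<otimes>\<^bsub>assoc_group X\<^esub> inv\<^bsub>assoc_group X\<^esub> a \<in> {?z}" by simp
qed

text \<open>\<open>As\<close> is left adjoint to \<open>Conj\<close>: compatibility with \<open>\<rhd>\<close> is the image of the defining relations.\<close>

lemma assoc_group_universal:
  assumes G: "group G" and f: "f \<in> rack_hom X (Conj G)"
  obtains h where "h \<in> hom (assoc_group X) G"
    and "\<And>x. x \<in> carrier X \<Longrightarrow> h (assoc_gen X x) = f x"
proof -
  interpret G: group G by (rule G)
  have f_carrier: "f \<in> carrier X \<rightarrow> carrier G"
    using f by (simp add: rack_hom_def Conj_def)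
  then have cl: "f x \<in> carrier G" if "x \<in> carrier X" for x using that by auto
  have conj: "f (x \<rhd> y) = f x \<otimes>\<^bsub>G\<^esub> f y \<otimes>\<^bsub>G\<^esub> inv\<^bsub>G\<^esub> f x"
    if "x \<in> carrier X" "y \<in> carrier X" for x y
    using f that by (simp add: rack_hom_def Conj_def)
  have "word_value G f u = word_value G f v" if uv: "(u, v) \<in> assoc_rels X" for u v
  proof -
    obtain x y where xy: "x \<in> carrier X" "y \<in> carrier X"
      and "u = [(x \<rhd> y, True)]" "v = [(x, True), (y, True), (x, False)]"
      using uv unfolding assoc_rels_def by blast
    then show ?thesis
      using conj[OF xy] cl[OF xy(1)] cl[OF xy(2)] cl[OF rack_op_closed[OF xy]]
      by (simp add: word_value_def G.m_assoc)
  qed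
  from G.presented_group_universal[OF f_carrier this]
  obtain h where "h \<in> hom (presented_group (carrier X) (assoc_rels X)) G"
    and "\<And>x. x \<in> carrier X \<Longrightarrow> h (pres_rel (carrier X) (assoc_rels X) `` {[(x, True)]}) = f x"
    by blast
  then show thesis
    by (intro that[of h]) (simp_all add: assoc_group_def assoc_gen_def)
qed

end

section \<open>Strong representations\<close>

lemma (in monoid) rev_prod_replicate:
  assumes "f x \<in> carrier G"
  shows "rev_prod G f (replicate k x) = f x [^] k"
proof (induction k)
  case (Suc k)
  have "replicate (Suc k) x = replicate k x @ [x]" by (simp add: replicate_append_same)
  then have "rev_prod G f (replicate (Suc k) x) = f x \<otimes> rev_prod G f (replicate k x)"
    by (simp only: rev_prod_def fold_append) simp
  then show ?case using assms Suc by (simp only: nat_pow_Suc2)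
qed (simp add: rev_prod_def)

lemma (in rack) strong_representation_pow_eq_one:
  assumes V: "vector_space scale" and \<rho>: "strong_representation scale X \<rho>"
    and x: "x \<in> carrier X"
    and n: "left_trans X x [^]\<^bsub>BijGroup (carrier X)\<^esub> n = \<one>\<^bsub>BijGroup (carrier X)\<^esub>"
  shows "\<rho> x [^]\<^bsub>GL scale\<^esub> (n::nat) = \<one>\<^bsub>GL scale\<^esub>"
proof -
  interpret B: group "BijGroup (carrier X)" by (rule group_BijGroup)
  interpret GL: group "GL scale" using V by (rule group_GL)
  have "stabilizing_family X (replicate n x)"
    using x n B.rev_prod_replicate[of "left_trans X" x n] left_trans_Bij[OF x]
    by (auto simp: stabilizing_family_def)
  then have "rev_prod (GL scale) \<rho> (replicate n x) = \<one>\<^bsub>GL scale\<^esub>"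
    using \<rho> by (simp add: strong_representation_def)
  moreover have "\<rho> x \<in> carrier (GL scale)"
    using \<rho> x by (auto simp: strong_representation_def rack_representation_def rack_hom_def Conj_def)
  ultimately show ?thesis using GL.rev_prod_replicate[of \<rho> x n] by simp
qed

lemma irreducible_family_mono:
  assumes "irreducible_family scale I T" and "\<And>i. i \<in> I \<Longrightarrow> \<exists>j \<in> J. U j = T i"
  shows "irreducible_family scale J U"
  unfolding irreducible_family_def
proof (intro conjI allI impI)
  show "(UNIV :: 'b set) \<noteq> {0}" using assms(1) by (simp add: irreducible_family_def)
  fix W assume W: "Modules.module.subspace scale W \<and> (\<forall>j \<in> J. U j ` W \<subseteq> W)"
  then have "\<forall>i \<in> I. T i ` W \<subseteq> W" using assms(2) by metis
  then show "W = {0} \<or> W = UNIV"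
    using W assms(1) by (simp add: irreducible_family_def)
qed

theorem theorem6p1:
  fixes X :: "'a rack_struct" and x0 :: 'a and n :: nat
    and scale :: "'k::field \<Rightarrow> 'v::ab_group_add \<Rightarrow> 'v"
    and \<rho> :: "'a \<Rightarrow> 'v \<Rightarrow> 'v"
  assumes "connected_rack X" and "finite (carrier X)"
    and "x0 \<in> carrier X"
    and "\<forall>x \<in> carrier X. group.ord (BijGroup (carrier X)) (left_trans X x) = n"
    and "vector_space scale"
    and "strong_representation scale X \<rho>"
  shows "\<exists>\<rho>bar. group_representation scale (enveloping_group X x0 n) \<rho>bar \<and>
    (\<forall>x \<in> carrier X.
      \<rho>bar (assoc_gen X x <#\<^bsub>assoc_group X\<^esub> enveloping_kernel X x0 n) = \<rho> x) \<and>
    (irreducible_rack_representation scale X \<rho> \<longrightarrow>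
      irreducible_group_representation scale (enveloping_group X x0 n) \<rho>bar)"
proof -
  interpret X: connected_rack X by fact
  interpret A: group "assoc_group X" by (rule group_assoc_group)
  interpret B: group "BijGroup (carrier X)" by (rule group_BijGroup)
  have GL: "group (GL scale)" using assms(5) by (rule group_GL)
  let ?N = "enveloping_kernel X x0 n"
  let ?z = "assoc_gen X x0 [^]\<^bsub>assoc_group X\<^esub> n"
  let ?coset = "\<lambda>x. assoc_gen X x <#\<^bsub>assoc_group X\<^esub> ?N"
  have n: "left_trans X x0 [^]\<^bsub>BijGroup (carrier X)\<^esub> n = \<one>\<^bsub>BijGroup (carrier X)\<^esub>"
    using B.pow_ord_eq_1[OF X.left_trans_Bij[OF assms(3)]] assms(3,4) by simp
  have N: "?N \<lhd> assoc_group X"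
    using assms(3) n by (rule X.enveloping_kernel_normal)
  have "\<rho> \<in> rack_hom X (Conj (GL scale))"
    using assms(6) by (simp add: strong_representation_def rack_representation_def)
  from X.assoc_group_universal[OF GL this] obtain \<phi> where \<phi>: "\<phi> \<in> hom (assoc_group X) (GL scale)"
    and \<phi>_gen: "\<And>x. x \<in> carrier X \<Longrightarrow> \<phi> (assoc_gen X x) = \<rho> x"
    by blast
  interpret \<phi>: group_hom "assoc_group X" "GL scale" \<phi>
    using A.is_group GL \<phi> by (simp add: group_hom_def group_hom_axioms_def)
  have "\<phi> ?z = \<rho> x0 [^]\<^bsub>GL scale\<^esub> n"
    using \<phi>.hom_nat_pow[OF assoc_gen_closed[OF assms(3)]] \<phi>_gen[OF assms(3)] by simp
  also have "\<dots> = \<one>\<^bsub>GL scale\<^esub>"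
    using assms(5,6,3) n by (rule X.strong_representation_pow_eq_one)
  finally have "?z \<in> kernel (assoc_group X) (GL scale) \<phi>"
    using assoc_gen_closed[OF assms(3)] by (simp add: kernel_def)
  then have "?N \<subseteq> kernel (assoc_group X) (GL scale) \<phi>"
    unfolding enveloping_kernel_def
    using \<phi>.subgroup_kernel by (intro A.generate_subgroup_incl) auto
  with N obtain \<sigma> where \<sigma>: "\<sigma> \<in> hom (assoc_group X Mod ?N) (GL scale)"
    and \<sigma>_coset: "\<And>a. a \<in> carrier (assoc_group X) \<Longrightarrow> \<sigma> (?N #>\<^bsub>assoc_group X\<^esub> a) = \<phi> a"
    by (rule \<phi>.FactGroup_universal_kernel) blast
  have coset: "?coset x = ?N #>\<^bsub>assoc_group X\<^esub> assoc_gen X x" if "x \<in> carrier X" for x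
    using normal.coset_eq[OF N] assoc_gen_closed[OF that] by simp
  have \<sigma>_rep: "group_representation scale (enveloping_group X x0 n) \<sigma>"
    using normal.factorgroup_is_group[OF N] GL \<sigma>
    by (simp add: group_representation_def enveloping_group_def group_hom_def group_hom_axioms_def)
  have \<sigma>_gen: "\<sigma> (?coset x) = \<rho> x" if "x \<in> carrier X" for x
    using coset[OF that] \<sigma>_coset[OF assoc_gen_closed[OF that]] \<phi>_gen[OF that] by simp
  have coset_mem: "?coset x \<in> carrier (enveloping_group X x0 n)" if "x \<in> carrier X" for x
    using coset[OF that] assoc_gen_closed[OF that]
    by (auto simp: enveloping_group_def carrier_FactGroup)
  have "irreducible_group_representation scale (enveloping_group X x0 n) \<sigma>"
    if "irreducible_rack_representation scale X \<rho>"
    unfolding irreducible_group_representation_def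
  proof
    have "irreducible_family scale (carrier X) \<rho>"
      using that by (simp add: irreducible_rack_representation_def)
    then show "irreducible_family scale (carrier (enveloping_group X x0 n)) \<sigma>"
      by (rule irreducible_family_mono) (use \<sigma>_gen coset_mem in blast)
  qed (rule \<sigma>_rep)
  with \<sigma>_rep \<sigma>_gen show ?thesis by blast
qed

end
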